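(* Let $\mathbf{F}:\mathbb{R}^n\times\mathbb{R}^d\to\mathbb{R}^n$ be a nonlinear parametric system with solution path $\mathbf{u}(\mathbf{p})$, let $\mathbf{u}_N(\mathbf{p})$ be a neural network approximation of $\mathbf{u}(\mathbf{p})$, and for $\lambda>0$ let $$f(\mathbf{u},\mathbf{p},\mathbf{v}):=\frac{\mathbf{v}^T\mathbf{F}_{\mathbf{u}}^T(\mathbf{u},\mathbf{p})\,\mathbf{F}_{\mathbf{u}}(\mathbf{u},\mathbf{p})\,\mathbf{v}}{\mathbf{v}^T\mathbf{v}}+\frac{\lambda}{2}\|\mathbf{F}(\mathbf{u},\mathbf{p})\|^2 .$$ Assume that $(\mathbf{u}(\mathbf{p}^* ),\mathbf{p}^*,\mathbf{v}^* )$ with $\|\mathbf{v}^*\|=1$ is the exact solution of the minimization problem for $f$ along the exact solution path, i.e. $(\mathbf{p}^*,\mathbf{v}^* )$ minimizes $(\mathbf{p},\mathbf{v})\mapsto f(\mathbf{u}(\mathbf{p}),\mathbf{p},\mathbf{v})$, and that $(\mathbf{u}_N(\mathbf{p}_N^* ),\mathbf{p}_N^*,\mathbf{v}_N^* )$ with $\|\mathbf{v}_N^*\|=1$ is the solution of the minimization problem along the network, i.e. $(\mathbf{p}_N^*,\mathbf{v}_N^* )$ minimizes $(\mathbf{p},\mathbf{v})\mapsto f(\mathbf{u}_N(\mathbf{p}),\mathbf{p},\mathbf{v})$. If $\frac{d\mathbf{F}_{\mathbf{u}}}{d\mathbf{p}}(\mathbf{u}(\mathbf{p}^* ),\mathbf{p}^*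 )\,\mathbf{v}^*$ is not in the range space of $\mathbf{F}_{\mathbf{u}}(\mathbf{u}(\mathbf{p}^* ),\mathbf{p}^* )$, then there are constants $C_1,C_2>0$ such that $$\|\mathbf{p}_N^*-\mathbf{p}^*\|^2\le C_1\,f(\mathbf{u}_N(\mathbf{p}_N^* ),\mathbf{p}_N^*,\mathbf{v}_N^* )+C_2\,\|\mathbf{u}_N(\mathbf{p}_N^* )-\mathbf{u}(\mathbf{p}_N^* )\| .$$
   Context: The solution path $\mathbf{u}=\mathbf{u}(\mathbf{p})$ is an $\mathbb{R}^n$-valued function of the parameter $\mathbf{p}\in\mathbb{R}^d$ satisfying $\mathbf{F}(\mathbf{u}(\mathbf{p}),\mathbf{p})=\mathbf{0}$. $\mathbf{F}_{\mathbf{u}}(\mathbf{u},\mathbf{p})\in\mathbb{R}^{n\times n}$ is the Jacobian of $\mathbf{F}$ with respect to $\mathbf{u}$. The minimizations are over parameters $\mathbf{p}$ and nonzero vectors $\mathbf{v}\in\mathbb{R}^n$; $\lambda$ is a fixed positive weight; the parameters (weights and biases) $\theta$ of the network $\mathbf{u}_N(\mathbf{p})=\mathbf{u}_N(\mathbf{p},\theta)$ are fixed (already trained). Norms are Euclidean. $\frac{d\mathbf{F}_{\mathbf{u}}}{d\mathbf{p}}$ denotes the total derivative of $\mathbf{p}\mapsto\mathbf{F}_{\mathbf{u}}(\mathbf{u}(\mathbf{p}),\mathbf{p})$, with components $\frac{d\mathbf{F}_{\mathbf{u}}}{dp_k}\in\mathbb{R}^{n\times n}$, $k=1,\dots,d$,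 and $\frac{d\mathbf{F}_{\mathbf{u}}}{d\mathbf{p}}\mathbf{v}^*$ is the $n\times d$ matrix with columns $\frac{d\mathbf{F}_{\mathbf{u}}}{dp_k}\mathbf{v}^*$. Saying that it is not in the range space of $\mathbf{F}_{\mathbf{u}}$ means that for every nonzero $\mathbf{x}\in\mathbb{R}^d$ the vector $\sum_k x_k\frac{d\mathbf{F}_{\mathbf{u}}}{dp_k}\mathbf{v}^*$ is not in the range of $\mathbf{F}_{\mathbf{u}}(\mathbf{u}(\mathbf{p}^* ),\mathbf{p}^* )$ (for $d=1$: the vector $\frac{d\mathbf{F}_{\mathbf{u}}}{dp}\mathbf{v}^*$ is not in that range). $\mathbf{F}$ and $\mathbf{u}$ are assumed smooth enough for these derivatives to exist.
   Formalization: As stated the claim fails if p* is not the only minimizing parameter; proved instead: with constants independent of the network when p_N* is near p* and v_N* near ±v*, and, if p* is the unique minimizing parameter, for every network with constants that may depend on it and its minimizer. *)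

theory Defs
  imports "HOL-Analysis.Analysis"
begin

definition jac_u :: "((real^'n) \<times> (real^'d) \<Rightarrow> real^'n) \<Rightarrow> real^'n \<Rightarrow> real^'d \<Rightarrow> real^'n^'n" where
  "jac_u F w p = jacobian (\<lambda>w. F (w, p)) (at w)"

text \<open>The smoothness the statement refers to: the Jacobian \<open>F\<^sub>u\<close> exists, it is differentiable jointly
  in \<open>(u, p)\<close>, and the path is differentiable, so that the total derivative of
  \<open>p \<mapsto> F\<^sub>u(u(p), p)\<close> exists by the chain rule. A \<open>C\<^sup>2\<close> map \<open>F\<close> and a \<open>C\<^sup>1\<close> path satisfy this.\<close>

definition smooth_enough :: "((real^'n) \<times> (real^'d) \<Rightarrow> real^'n) \<Rightarrow> (real^'d \<Rightarrow> real^'n) \<Rightarrow> bool" where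
  "smooth_enough F u \<longleftrightarrow>
     (\<forall>w p. (\<lambda>w. F (w, p)) differentiable (at w)) \<and>
     (\<lambda>(w, p). jac_u F w p) differentiable_on UNIV \<and>
     u differentiable_on UNIV"

definition objective ::
  "((real^'n) \<times> (real^'d) \<Rightarrow> real^'n) \<Rightarrow> real \<Rightarrow> real^'n \<Rightarrow> real^'d \<Rightarrow> real^'n \<Rightarrow> real" where
  "objective F lam w p v =
     (v \<bullet> ((transpose (jac_u F w p) ** jac_u F w p) *v v)) / (v \<bullet> v)
       + lam / 2 * (norm (F (w, p)))\<^sup>2"

definition minimizes_along ::
  "((real^'n) \<times> (real^'d) \<Rightarrow> real^'n) \<Rightarrow> real \<Rightarrow> (real^'d \<Rightarrow> real^'n) \<Rightarrow> real^'d \<Rightarrow> real^'n \<Rightarrow> bool" where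
  "minimizes_along F lam w p v \<longleftrightarrow>
     is_arg_min (\<lambda>(q, z). objective F lam (w q) q z) (\<lambda>(q, z). z \<noteq> 0) (p, v)"

definition total_deriv_jac ::
  "((real^'n) \<times> (real^'d) \<Rightarrow> real^'n) \<Rightarrow> (real^'d \<Rightarrow> real^'n) \<Rightarrow> real^'d \<Rightarrow> 'd \<Rightarrow> real^'n^'n" where
  "total_deriv_jac F u p k = frechet_derivative (\<lambda>p. jac_u F (u p) p) (at p) (axis k 1)"

definition total_deriv_jac_mult ::
  "((real^'n) \<times> (real^'d) \<Rightarrow> real^'n) \<Rightarrow> (real^'d \<Rightarrow> real^'n) \<Rightarrow> real^'d \<Rightarrow> real^'n \<Rightarrow> real^'d^'n" where
  "total_deriv_jac_mult F u p v = (\<chi> i k. (total_deriv_jac F u p k *v v) $ i)"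

definition not_in_range_space :: "real^'d^'n \<Rightarrow> real^'n^'n \<Rightarrow> bool" where
  "not_in_range_space M A \<longleftrightarrow> (\<forall>x. x \<noteq> 0 \<longrightarrow> M *v x \<notin> range ((*v) A))"

end

theory Submission
  imports Defs
begin

text \<open>Write \<open>A = F\<^sub>u(u(p\<^sup>*), p\<^sup>*)\<close> and let \<open>G\<close> be the total derivative of \<open>F\<^sub>u\<close> along the path.
  Compactness of the unit sphere turns the range condition into
  \<open>\<parallel>G(x) v\<^sup>* + A y\<parallel> \<ge> c \<parallel>x\<parallel>\<close> for all \<open>x\<close> and \<open>y\<close>. Expanding \<open>F\<^sub>u(u(p) + h, p)\<close> to first order at
  \<open>(h, p) = (0, p\<^sup>*)\<close> and absorbing \<open>F\<^sub>u v\<close> at the base point into \<open>A y\<close> gives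
  \<open>(c/2) \<parallel>p - p\<^sup>*\<parallel> \<le> \<parallel>F\<^sub>u(u(p) + h, p) v\<parallel> + K \<parallel>h\<parallel>\<close> for \<open>h\<close> small and \<open>v\<close> near \<open>v\<^sup>*\<close>; squaring and
  using that \<open>\<parallel>F\<^sub>u v\<parallel>\<^sup>2\<close> is bounded by the objective yields the estimate. For large \<open>h = u\<^sub>N(p) - u(p)\<close>
  the term \<open>C\<^sub>2 \<parallel>h\<parallel>\<close> alone suffices.

  In the second claim the constants may depend on the network, so only a vanishing right-hand side
  has to be excluded: then \<open>(p\<^sub>N\<^sup>*, v\<^sub>N\<^sup>*)\<close> also minimizes along the exact path.\<close>

lemma norm_matrix_vector_mult_le:
  fixes M :: "real^'m^'n"
  shows "norm (M *v v) \<le> norm M * norm v"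
proof -
  have "norm (M *v v) = L2_set (\<lambda>i. norm (row i M \<bullet> v)) UNIV"
    by (simp add: norm_vec_def matrix_vector_mul_component row_def)
  also have "\<dots> \<le> L2_set (\<lambda>i. norm (M $ i) * norm v) UNIV"
    by (rule L2_set_mono) (auto simp: row_def Cauchy_Schwarz_ineq2)
  also have "\<dots> = norm M * norm v"
    by (simp add: norm_vec_def L2_set_left_distrib)
  finally show ?thesis .
qed

lemma inner_gram_matrix:
  fixes A :: "real^'m^'n"
  shows "v \<bullet> ((transpose A ** A) *v v) = (norm (A *v v))\<^sup>2"
  by (metis dot_lmul_matrix matrix_vector_mul_assoc power2_norm_eq_inner
      transpose_matrix_vector transpose_transpose)

lemma objective_nonneg:
  assumes "lam > 0"
  shows "objective F lam w p v \<ge> 0"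
  using assms by (simp add: objective_def inner_gram_matrix)

lemma norm_jac_u_le_objective:
  assumes "lam > 0" "norm v = 1"
  shows "(norm (jac_u F w p *v v))\<^sup>2 \<le> objective F lam w p v"
  using assms by (simp add: objective_def inner_gram_matrix flip: power2_norm_eq_inner)

text \<open>By linearity \<open>G\<close> is determined by its values on the coordinate axes. This
  links the columnwise matrix in the range condition to the Frechet derivative used in first-order
  expansions.\<close>

lemma total_deriv_jac_mult_vector:
  assumes "((\<lambda>p. jac_u F (u p) p) has_derivative G) (at p)"
  shows "total_deriv_jac_mult F u p v *v x = G x *v v"
proof -
  have G: "frechet_derivative (\<lambda>p. jac_u F (u p) p) (at p) = G"
    using assms by (rule frechet_derivative_at [symmetric])
  have "linear G"
    using assms has_derivative_linear by blast
  then have "G x = (\<Sum>k\<in>UNIV. x $ k *\<^sub>R G (axis k 1))"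
    by (subst basis_expansion [of x, symmetric])
       (simp add: linear_sum linear_cmul scalar_mult_eq_scaleR)
  then show ?thesis
    unfolding total_deriv_jac_mult_def total_deriv_jac_def G
    by (simp add: vec_eq_iff matrix_vector_mult_def sum_distrib_left sum_distrib_right
        mult_ac) (auto intro: sum.swap)
qed

text \<open>The distance from \<open>L x\<close> to the closed set \<open>S\<close> is continuous
  and positive on the unit sphere, hence has a positive minimum \<open>c\<close> there. Rescaling by
  \<open>norm x\<close> extends the bound to all \<open>x\<close>.\<close>

lemma transversality_constant:
  fixes L :: "'a::euclidean_space \<Rightarrow> 'b::euclidean_space" and S :: "'b set"
  assumes L: "linear L" and S: "subspace S" and disj: "\<And>x. x \<noteq> 0 \<Longrightarrow> L x \<notin> S"
  shows "\<exists>c>0. \<forall>x. \<forall>y\<in>S. c * norm x \<le> norm (L x + y)"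
proof -
  have "S \<noteq> {}" "closed S"
    using S subspace_0 closed_subspace by auto
  have "continuous_on (sphere 0 1) (\<lambda>x. infdist (L x) S)"
    by (intro continuous_on_infdist linear_continuous_on linear_conv_bounded_linear [THEN iffD1] L)
  moreover have "sphere (0::'a) 1 \<noteq> {}"
    by simp
  ultimately have "\<exists>x0\<in>sphere 0 1. \<forall>x\<in>sphere 0 1. infdist (L x0) S \<le> infdist (L x) S"
    by (intro continuous_attains_inf compact_sphere)
  then obtain x0 where x0: "norm x0 = 1"
    and min: "\<And>x. norm x = 1 \<Longrightarrow> infdist (L x0) S \<le> infdist (L x) S"
    by auto
  define c where "c = infdist (L x0) S"
  have "x0 \<noteq> 0"
    using x0 by auto
  then have "c > 0"
    using disj [of x0] \<open>S \<noteq> {}\<close> \<open>closed S\<close> infdist_pos_not_in_closed unfolding c_def by blast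
  moreover have "c * norm x \<le> norm (L x + y)" if "y \<in> S" for x y
  proof (cases "x = 0")
    case False
    define r where "r = norm x"
    have "r > 0"
      using False by (simp add: r_def)
    have "- (y /\<^sub>R r) \<in> S"
      using that S by (simp add: subspace_neg subspace_scale)
    then have "infdist (L (x /\<^sub>R r)) S \<le> dist (L (x /\<^sub>R r)) (- (y /\<^sub>R r))"
      by (rule infdist_le)
    moreover have "c \<le> infdist (L (x /\<^sub>R r)) S"
      unfolding c_def using \<open>r > 0\<close> by (intro min) (simp add: r_def)
    moreover have "dist (L (x /\<^sub>R r)) (- (y /\<^sub>R r)) = norm ((L x + y) /\<^sub>R r)"
      using L by (simp add: dist_norm linear_cmul scaleR_right_distrib)
    ultimately have "c \<le> norm (L x + y) / r"
      using \<open>r > 0\<close> by (simp add: divide_inverse mult.commute)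
    then show ?thesis
      using \<open>r > 0\<close> by (simp add: r_def field_simps)
  qed simp
  ultimately show ?thesis
    by blast
qed

text \<open>The first-order change in \<open>p\<close> is transverse to the range of
  \<open>\<Phi> (0, p0)\<close>, so the base term cannot cancel it. The direction \<open>h\<close>,
  for which no transversality is assumed, is paid for by \<open>K * norm h\<close>.\<close>

lemma matrix_family_lower_bound:
  fixes \<Phi> :: "'a::euclidean_space \<times> 'b::euclidean_space \<Rightarrow> real^'m^'n"
  assumes deriv: "(\<Phi> has_derivative D) (at (0, p0))"
    and transv: "\<And>x. x \<noteq> 0 \<Longrightarrow> D (0, x) *v v0 \<notin> range ((*v) (\<Phi> (0, p0)))"
  obtains \<delta> c K where "\<delta> > 0" "c > 0" "K > 0"
    "\<And>h p v. \<lbrakk>norm h < \<delta>; norm (p - p0) < \<delta>; norm (v - v0) < \<delta>; norm v = 1\<rbrakk> \<Longrightarrow>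
       c * norm (p - p0) \<le> norm (\<Phi> (h, p) *v v) + K * norm h"
proof -
  define A where "A = \<Phi> (0, p0)"
  have blD: "bounded_linear D"
    using deriv by (rule has_derivative_bounded_linear)
  interpret D: bounded_linear D
    by (rule blD)
  obtain K where "K > 0" and K: "\<And>z. norm (D z) \<le> norm z * K"
    using D.pos_bounded by blast
  have "linear (\<lambda>x. D (0, x) *v v0)"
  proof (rule linearI)
    fix x y
    show "D (0, x + y) *v v0 = D (0, x) *v v0 + D (0, y) *v v0"
      using D.add [of "(0, x)" "(0, y)"] by (simp add: matrix_vector_mult_add_rdistrib)
    fix r
    show "D (0, r *\<^sub>R x) *v v0 = r *\<^sub>R (D (0, x) *v v0)"
      using D.scaleR [of r "(0, x)"] by (simp add: scaleR_matrix_vector_assoc)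
  qed
  moreover have "subspace (range ((*v) A))"
    by (simp add: linear_subspace_image)
  ultimately have "\<exists>c>0. \<forall>x. \<forall>y\<in>range ((*v) A). c * norm x \<le> norm (D (0, x) *v v0 + y)"
    using transv unfolding A_def by (rule transversality_constant)
  then obtain c where "c > 0" and c: "\<And>x y. c * norm x \<le> norm (D (0, x) *v v0 + A *v y)"
    by blast
  obtain r where "r > 0" and r: "\<And>z. norm (z - (0, p0)) < r \<Longrightarrow>
      norm (\<Phi> z - A - D (z - (0, p0))) \<le> c / 4 * norm (z - (0, p0))"
    using deriv \<open>c > 0\<close> unfolding has_derivative_at_alt A_def
    by (metis divide_pos_pos zero_less_numeral)
  \<comment> \<open>The bound \<open>r / 2\<close> keeps \<open>(h, p - p0)\<close> within the
    radius of the expansion; \<open>c / (4 * K)\<close> limits the cost of replacing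
    \<open>v\<close> by \<open>v0\<close> to \<open>c / 4 * norm x\<close>.\<close>
  define \<delta> where "\<delta> = min (r / 2) (c / (4 * K))"
  show thesis
  proof (rule that)
    \<comment> \<open>Of \<open>c\<close>, one quarter is lost to the remainder and one to replacing
      \<open>v\<close> by \<open>v0\<close>; the terms in \<open>h\<close> add up to
      \<open>K + c / 4\<close>.\<close>
    show "\<delta> > 0" "c / 2 > 0" "K + c / 4 > 0"
      using \<open>r > 0\<close> \<open>c > 0\<close> \<open>K > 0\<close> by (auto simp: \<delta>_def)
    fix h :: 'a and p and v :: "real^'m"
    assume h: "norm h < \<delta>" and p: "norm (p - p0) < \<delta>" and v: "norm (v - v0) < \<delta>" "norm v = 1"
    define x where "x = p - p0"
    define R where "R = \<Phi> (h, p) - A - D (h, x)"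
    have hx: "norm (h, x) \<le> norm h + norm x"
      by (rule norm_Pair_le)
    moreover have "norm h + norm x < r"
      using h p by (simp add: \<delta>_def x_def)
    ultimately have "norm R \<le> c / 4 * norm (h, x)"
      using r [of "(h, p)"] by (simp add: R_def x_def)
    also have "\<dots> \<le> c / 4 * (norm h + norm x)"
      using hx \<open>c > 0\<close> by (intro mult_left_mono) auto
    finally have R: "norm (R *v v) \<le> c / 4 * (norm h + norm x)"
      using norm_matrix_vector_mult_le [of R v] v by simp
    have Dh: "norm (D (h, 0) *v v) \<le> K * norm h"
      using norm_matrix_vector_mult_le [of "D (h, 0)" v] K [of "(h, 0)"] v
      by (simp add: mult.commute)
    have "norm (D (0, x) *v (v - v0)) \<le> (norm x * K) * (c / (4 * K))"
      using norm_matrix_vector_mult_le [of "D (0, x)" "v - v0"] K [of "(0, x)"] v \<open>K > 0\<close>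
      by (elim order_trans, intro mult_mono) (auto simp: \<delta>_def)
    then have Dx: "norm (D (0, x) *v (v - v0)) \<le> c / 4 * norm x"
      using \<open>K > 0\<close> by (simp add: field_simps)
    have "D (h, x) = D (h, 0) + D (0, x)"
      using D.add [of "(h, 0)" "(0, x)"] by simp
    then have "\<Phi> (h, p) = A + D (h, 0) + D (0, x) + R"
      by (simp add: R_def)
    \<comment> \<open>The term \<open>A *v v\<close> need not be small: it lies in the range of
      \<open>A\<close>, so it stays on the left, where the lower bound with constant
      \<open>c\<close> covers it.\<close>
    then have "D (0, x) *v v0 + A *v v =
        \<Phi> (h, p) *v v - D (h, 0) *v v - D (0, x) *v (v - v0) - R *v v"
      by (simp add: matrix_vector_mult_add_rdistrib matrix_vector_mult_diff_distrib)
    then have "norm (D (0, x) *v v0 + A *v v) \<le> norm (\<Phi> (h, p) *v v) + norm (D (h, 0) *v v)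
        + norm (D (0, x) *v (v - v0)) + norm (R *v v)"
      by (smt (verit) norm_triangle_ineq4)
    moreover have "c * norm x \<le> norm (D (0, x) *v v0 + A *v v)"
      by (rule c)
    ultimately show "c / 2 * norm (p - p0) \<le> norm (\<Phi> (h, p) *v v) + (K + c / 4) * norm h"
      using R Dh Dx unfolding x_def [symmetric] by (simp add: algebra_simps)
  qed
qed

text \<open>The substitution \<open>w = u p + h\<close> straightens the solution path to
  \<open>h = 0\<close>, so that the partial derivative in \<open>p\<close> becomes the total
  derivative of the range condition.\<close>

lemma jac_u_lower_bound:
  fixes F :: "(real^'n) \<times> (real^'d) \<Rightarrow> real^'n" and u :: "real^'d \<Rightarrow> real^'n"
  assumes smooth: "smooth_enough F u"
    and range: "not_in_range_space (total_deriv_jac_mult F u ps vs) (jac_u F (u ps) ps)"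
  obtains \<delta> c K where "\<delta> > 0" "c > 0" "K > 0"
    "\<And>w p v. \<lbrakk>norm (w - u p) < \<delta>; norm (p - ps) < \<delta>; norm (v - vs) < \<delta>; norm v = 1\<rbrakk> \<Longrightarrow>
       c * norm (p - ps) \<le> norm (jac_u F w p *v v) + K * norm (w - u p)"
proof -
  have "(\<lambda>z. jac_u F (fst z) (snd z)) differentiable (at (u ps, ps))"
    using smooth by (simp add: smooth_enough_def differentiable_on_def case_prod_unfold)
  then obtain DB where DB: "((\<lambda>z. jac_u F (fst z) (snd z)) has_derivative DB) (at (u ps, ps))"
    by (auto simp: differentiable_def)
  have "u differentiable (at ps)"
    using smooth by (simp add: smooth_enough_def differentiable_on_def)
  then obtain Du where Du: "(u has_derivative Du) (at ps)"
    by (auto simp: differentiable_def)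
  define D where "D = (\<lambda>z. DB (Du (snd z) + fst z, snd z))"
  define \<Phi> where "\<Phi> = (\<lambda>z. jac_u F (u (snd z) + fst z) (snd z))"
  have "((\<lambda>z. u (snd z)) has_derivative (\<lambda>z. Du (snd z))) (at (0::real^'n, ps))"
    by (rule has_derivative_compose [of snd snd]) (auto intro!: derivative_eq_intros Du)
  then have "((\<lambda>z. (u (snd z) + fst z, snd z)) has_derivative
      (\<lambda>z. (Du (snd z) + fst z, snd z))) (at (0::real^'n, ps))"
    by (auto intro!: derivative_eq_intros)
  then have \<Phi>: "(\<Phi> has_derivative D) (at (0, ps))"
    using has_derivative_compose [of _ _ "(0, ps)" UNIV] DB unfolding \<Phi>_def D_def by fastforce
  have "((\<lambda>p. (0::real^'n, p)) has_derivative (\<lambda>x. (0, x))) (at ps)"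
    by (auto intro!: derivative_eq_intros)
  then have "((\<lambda>p. \<Phi> (0, p)) has_derivative (\<lambda>x. D (0, x))) (at ps)"
    using has_derivative_compose \<Phi> by fastforce
  then have total: "((\<lambda>p. jac_u F (u p) p) has_derivative (\<lambda>x. D (0, x))) (at ps)"
    by (simp add: \<Phi>_def)
  have "D (0, x) *v vs \<notin> range ((*v) (\<Phi> (0, ps)))" if "x \<noteq> 0" for x
    using range that
    by (simp add: not_in_range_space_def total_deriv_jac_mult_vector [OF total] \<Phi>_def)
  then obtain \<delta> c K where *: "\<delta> > 0" "c > 0" "K > 0"
    "\<And>h p v. \<lbrakk>norm h < \<delta>; norm (p - ps) < \<delta>; norm (v - vs) < \<delta>; norm v = 1\<rbrakk> \<Longrightarrow>
       c * norm (p - ps) \<le> norm (\<Phi> (h, p) *v v) + K * norm h"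
    using matrix_family_lower_bound [OF \<Phi>, of vs] by metis
  show thesis
  proof (rule that [OF *(1-3)])
    fix w p and v :: "real^'n"
    assume "norm (w - u p) < \<delta>" "norm (p - ps) < \<delta>" "norm (v - vs) < \<delta>" "norm v = 1"
    then show "c * norm (p - ps) \<le> norm (jac_u F w p *v v) + K * norm (w - u p)"
      using *(4) [of "w - u p" p v] by (simp add: \<Phi>_def)
  qed
qed

text \<open>The range condition is local at \<open>(ps, vs)\<close>, so constants common to all
  networks are claimed only near that point, up to the sign of \<open>v\<close>, which the objective
  does not see. Without nearness, \<open>ps\<close> is required to be the only minimizing parameter
  and the constants are chosen per network.\<close>

theorem theorem3p2:
  fixes F :: "(real^'n) \<times> (real^'d) \<Rightarrow> real^'n"
    and u :: "real^'d \<Rightarrow> real^'n"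
    and lam :: real
    and ps :: "real^'d" and vs :: "real^'n"
  assumes "lam > 0"
    and "\<And>p. F (u p, p) = 0"
    and "smooth_enough F u"
    and "norm vs = 1" and "minimizes_along F lam u ps vs"
    and "not_in_range_space (total_deriv_jac_mult F u ps vs) (jac_u F (u ps) ps)"
  shows "(\<exists>\<delta>>0. \<exists>C1>0. \<exists>C2>0. \<forall>(uN :: real^'d \<Rightarrow> real^'n) pN vN.
            norm vN = 1 \<and> minimizes_along F lam uN pN vN \<and>
            norm (pN - ps) < \<delta> \<and> (norm (vN - vs) < \<delta> \<or> norm (vN + vs) < \<delta>) \<longrightarrow>
              (norm (pN - ps))\<^sup>2 \<le> C1 * objective F lam (uN pN) pN vN + C2 * norm (uN pN - u pN))
       \<and> ((\<forall>q z. minimizes_along F lam u q z \<longrightarrow> q = ps) \<longrightarrow>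
          (\<forall>(uN :: real^'d \<Rightarrow> real^'n) pN vN.
            norm vN = 1 \<and> minimizes_along F lam uN pN vN \<longrightarrow>
              (\<exists>C1>0. \<exists>C2>0.
                (norm (pN - ps))\<^sup>2 \<le> C1 * objective F lam (uN pN) pN vN + C2 * norm (uN pN - u pN))))"
proof (intro conjI impI allI)
  obtain \<delta> c K where pos: "\<delta> > 0" "c > 0" "K > 0"
    and lower: "\<And>w p v. \<lbrakk>norm (w - u p) < \<delta>; norm (p - ps) < \<delta>; norm (v - vs) < \<delta>; norm v = 1\<rbrakk>
       \<Longrightarrow> c * norm (p - ps) \<le> norm (jac_u F w p *v v) + K * norm (w - u p)"
    using jac_u_lower_bound [OF assms(3,6)] by blast
  \<comment> \<open>Both constants come from dividing the squared lower bound by the square of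
    \<open>c\<close>; the extra summand \<open>\<delta>\<close> in \<open>C2\<close> serves the case
    where the network error is at least \<open>\<delta>\<close>.\<close>
  define C1 where "C1 = 2 / c\<^sup>2"
  define C2 where "C2 = 2 * K\<^sup>2 * \<delta> / c\<^sup>2 + \<delta>"
  have C: "C1 > 0" "C2 > 0"
    using pos by (auto simp: C1_def C2_def add_nonneg_pos)
  have estimate: "(norm (p - ps))\<^sup>2 \<le> C1 * objective F lam w p v + C2 * norm (w - u p)"
    if v: "norm v = 1" and p: "norm (p - ps) < \<delta>" and near: "norm (v - vs) < \<delta> \<or> norm (v + vs) < \<delta>"
    for w p v
  proof (cases "norm (w - u p) < \<delta>")
    case True
    define x h b where "x = norm (p - ps)" and "h = norm (w - u p)" and "b = norm (jac_u F w p *v v)"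
    \<comment> \<open>For \<open>v\<close> near \<open>- vs\<close> the lower bound is applied to
      \<open>- v\<close>.\<close>
    have "jac_u F w p *v (- v) = - (jac_u F w p *v v)"
      using matrix_vector_mult_diff_distrib [of "jac_u F w p" 0 v] by simp
    then have "norm (jac_u F w p *v (- v)) = b"
      by (simp add: b_def)
    moreover have "norm (- v - vs) = norm (v + vs)"
      by (metis minus_add_distrib norm_minus_cancel uminus_add_conv_diff add.commute)
    ultimately have "c * x \<le> b + K * h"
      using near lower [OF True p, of v] lower [OF True p, of "- v"] v
      unfolding x_def h_def b_def by auto
    then have "(c * x)\<^sup>2 \<le> (b + K * h)\<^sup>2"
      using pos by (intro power_mono) (auto simp: x_def)
    also have "\<dots> \<le> 2 * b\<^sup>2 + 2 * (K * h)\<^sup>2"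
      using zero_le_power2 [of "b - K * h"] by (simp add: power2_eq_square algebra_simps)
    also have "\<dots> \<le> 2 * objective F lam w p v + 2 * K\<^sup>2 * \<delta> * h"
    proof (intro add_mono)
      show "2 * b\<^sup>2 \<le> 2 * objective F lam w p v"
        using norm_jac_u_le_objective [OF assms(1) v] by (simp add: b_def)
      \<comment> \<open>Smallness of \<open>h\<close> turns the quadratic error into a linear
        one.\<close>
      have "h * h \<le> \<delta> * h"
        using True by (intro mult_right_mono) (auto simp: h_def)
      then show "2 * (K * h)\<^sup>2 \<le> 2 * K\<^sup>2 * \<delta> * h"
        by (simp add: power_mult_distrib power2_eq_square [of h] mult.assoc mult_left_mono)
    qed
    finally have "x\<^sup>2 \<le> C1 * objective F lam w p v + 2 * K\<^sup>2 * \<delta> / c\<^sup>2 * h"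
      using pos by (simp add: C1_def field_simps power_mult_distrib)
    moreover have "0 \<le> \<delta> * h"
      using pos by (simp add: h_def)
    ultimately show ?thesis
      unfolding x_def h_def C2_def by (simp add: algebra_simps)
  next
    case False
    \<comment> \<open>Here \<open>norm (p - ps) < \<delta> \<le> norm (w - u p)\<close>.\<close>
    have "(norm (p - ps))\<^sup>2 \<le> \<delta> * norm (w - u p)"
      unfolding power2_eq_square using p False pos by (intro mult_mono) auto
    also have "\<dots> \<le> C2 * norm (w - u p)"
      using pos by (intro mult_right_mono) (auto simp: C2_def)
    also have "\<dots> \<le> C1 * objective F lam w p v + C2 * norm (w - u p)"
      using objective_nonneg [OF assms(1), of F w p v] C by simp
    finally show ?thesis .
  qed
  show "\<exists>\<delta>>0. \<exists>C1>0. \<exists>C2>0. \<forall>(uN :: real^'d \<Rightarrow> real^'n) pN vN.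
            norm vN = 1 \<and> minimizes_along F lam uN pN vN \<and>
            norm (pN - ps) < \<delta> \<and> (norm (vN - vs) < \<delta> \<or> norm (vN + vs) < \<delta>) \<longrightarrow>
              (norm (pN - ps))\<^sup>2 \<le> C1 * objective F lam (uN pN) pN vN + C2 * norm (uN pN - u pN)"
    using pos(1) C estimate by blast
next
  fix uN :: "real^'d \<Rightarrow> real^'n" and pN vN
  assume unique: "\<forall>q z. minimizes_along F lam u q z \<longrightarrow> q = ps"
    and N: "norm vN = 1 \<and> minimizes_along F lam uN pN vN"
  define S where "S = objective F lam (uN pN) pN vN + norm (uN pN - u pN)"
  have nonneg: "objective F lam w p v \<ge> 0" for w p v
    by (rule objective_nonneg [OF assms(1)])
  have "pN = ps" if "S = 0"
  proof -
    have "objective F lam (uN pN) pN vN = 0 \<and> uN pN = u pN"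
      using that add_nonneg_eq_0_iff [OF nonneg norm_ge_zero] unfolding S_def by fastforce
    then have "objective F lam (u pN) pN vN = 0"
      by metis
    \<comment> \<open>The value 0 is a global minimum because the objective is nonnegative.\<close>
    then have "minimizes_along F lam u pN vN"
      using N nonneg by (auto simp: minimizes_along_def is_arg_min_def not_less)
    then show ?thesis
      using unique by blast
  qed
  moreover have "S \<ge> 0"
    using nonneg by (simp add: S_def)
  \<comment> \<open>The same factor serves as \<open>C1\<close> and \<open>C2\<close>. The summand 1
    makes it positive; for \<open>S = 0\<close> the quotient is 0 and both sides vanish.\<close>
  ultimately have "(norm (pN - ps))\<^sup>2 \<le> ((norm (pN - ps))\<^sup>2 / S + 1) * S"
    by (cases "S = 0") (auto simp: algebra_simps)
  moreover have "(norm (pN - ps))\<^sup>2 / S + 1 > 0"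
    using \<open>S \<ge> 0\<close> by (simp add: add_nonneg_pos)
  ultimately show "\<exists>C1>0. \<exists>C2>0.
      (norm (pN - ps))\<^sup>2 \<le> C1 * objective F lam (uN pN) pN vN + C2 * norm (uN pN - u pN)"
    unfolding S_def distrib_left by blast
qed

end
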